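(* Homotopy and open homotopy of Gauss words are different: there exist two Gauss words that are homotopic but not open homotopic.
   Context: An alphabet is a finite set, whose elements are called letters. A word on an alphabet $\mathcal{A}$ is a finite (possibly empty) sequence of letters of $\mathcal{A}$. A Gauss word on $\mathcal{A}$ is a word in which every letter of $\mathcal{A}$ appears exactly twice (so $\mathcal{A}$ is the set of letters appearing in the word). Gauss words $u$ on $\mathcal{A}$ and $v$ on $\mathcal{B}$ are isomorphic if there is a bijection $f:\mathcal{A}\to\mathcal{B}$ such that $f$ applied letterwise to $u$ gives $v$. The homotopy moves on Gauss words are the following (each may be applied in either direction), where $A,B,C$ are individual (distinct) letters and $t,x,y,z$ are arbitrary, possibly empty, sequences of letters such that both sides are Gauss words: Shift: $AxAy \leftrightarrow xAyA$; H1: $xAAy \leftrightarrow xy$; H2: $xAByBAz \leftrightarrow xyz$; H3: $xAByACzBCt \leftrightarrow xBAyCAzCBt$. Two Gauss words are homotopic if one can be transformed into the other by a finite sequence of isomorphisms and homotopy moves (Shift, H1, H2, H3). Two Gauss words are open homotopic if one can be transformed into the other by a finite sequence of isomorphisms and moves H1, H2, H3 (the shift move not being allowed). *)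

theory Defs
  imports Main
begin

definition gauss_word_on :: "'a set \<Rightarrow> 'a list \<Rightarrow> bool" where
  "gauss_word_on A w \<longleftrightarrow> finite A \<and> set w \<subseteq> A \<and> (\<forall>a\<in>A. count_list w a = 2)"

definition gauss_word :: "'a list \<Rightarrow> bool" where
  "gauss_word w \<longleftrightarrow> (\<exists>A. gauss_word_on A w)"

definition gauss_iso :: "'a list \<Rightarrow> 'b list \<Rightarrow> bool" where
  "gauss_iso u v \<longleftrightarrow>
     (\<exists>A B f. gauss_word_on A u \<and> gauss_word_on B v \<and> bij_betw f A B \<and> map f u = v)"

text \<open>
  The moves, left to right; the inverse moves are supplied by the equivalence closure below.
  That both sides are Gauss words forces the letters A, B, C to be absent from x, y, z, t.
\<close>

inductive shift_move :: "'a list \<Rightarrow> 'a list \<Rightarrow> bool" where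
  "\<lbrakk>gauss_word ([A] @ x @ [A] @ y); gauss_word (x @ [A] @ y @ [A])\<rbrakk>
    \<Longrightarrow> shift_move ([A] @ x @ [A] @ y) (x @ [A] @ y @ [A])"

inductive H1_move :: "'a list \<Rightarrow> 'a list \<Rightarrow> bool" where
  "\<lbrakk>gauss_word (x @ [A, A] @ y); gauss_word (x @ y)\<rbrakk>
    \<Longrightarrow> H1_move (x @ [A, A] @ y) (x @ y)"

inductive H2_move :: "'a list \<Rightarrow> 'a list \<Rightarrow> bool" where
  "\<lbrakk>A \<noteq> B; gauss_word (x @ [A, B] @ y @ [B, A] @ z); gauss_word (x @ y @ z)\<rbrakk>
    \<Longrightarrow> H2_move (x @ [A, B] @ y @ [B, A] @ z) (x @ y @ z)"

inductive H3_move :: "'a list \<Rightarrow> 'a list \<Rightarrow> bool" where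
  "\<lbrakk>distinct [A, B, C];
    gauss_word (x @ [A, B] @ y @ [A, C] @ z @ [B, C] @ t);
    gauss_word (x @ [B, A] @ y @ [C, A] @ z @ [C, B] @ t)\<rbrakk>
    \<Longrightarrow> H3_move (x @ [A, B] @ y @ [A, C] @ z @ [B, C] @ t)
                (x @ [B, A] @ y @ [C, A] @ z @ [C, B] @ t)"

definition open_homotopy_step :: "'a list \<Rightarrow> 'a list \<Rightarrow> bool" where
  "open_homotopy_step u v \<longleftrightarrow> gauss_iso u v \<or> H1_move u v \<or> H2_move u v \<or> H3_move u v"

definition homotopy_step :: "'a list \<Rightarrow> 'a list \<Rightarrow> bool" where
  "homotopy_step u v \<longleftrightarrow> open_homotopy_step u v \<or> shift_move u v"

text \<open>
  All words of a homotopy use letters from the type \<open>'a\<close>, while the number of letters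
  may grow along the way. The notions below are therefore the intended ones only when \<open>'a\<close>
  is infinite; then finite alphabets are no restriction, since every finite alphabet is in
  bijection with a finite subset of \<open>'a\<close>.
\<close>

definition homotopic :: "'a list \<Rightarrow> 'a list \<Rightarrow> bool" where
  "homotopic u v \<longleftrightarrow> gauss_word u \<and> gauss_word v \<and> equivclp homotopy_step u v"

definition open_homotopic :: "'a list \<Rightarrow> 'a list \<Rightarrow> bool" where
  "open_homotopic u v \<longleftrightarrow> gauss_word u \<and> gauss_word v \<and> equivclp open_homotopy_step u v"

end

theory Submission
  imports Defs
begin

text \<open>
  Two letters of a Gauss word are linked if their occurrences alternate.  Call a letter even or
  odd according to the parity of the number of letters linked with it, and give every letter a
  colour: \<open>0\<close> if it is even, and \<open>1\<close> or \<open>-1\<close> if it is odd, according to the parity of the number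
  of \<^emph>\<open>even\<close> letters linked with it.  The alternating sum of the colours, read along the word,
  is an invariant of open homotopy:

  \<^item> H1 removes two adjacent copies of one letter, and H2 removes two adjacent pairs of letters
    of the same colour, because the two letters are linked with the same letters.  In both cases
    the removed terms cancel and every remaining entry keeps the parity of its position.  No
    other colour changes: another letter is linked with neither or with both of the letters
    removed by H2, and with none removed by H1.

  \<^item> In H3 either all three letters or exactly one of them is even.  In the first case the
    move permutes zeros.  In the second case each odd letter becomes linked, or ceases
    to be linked, with the even one, so that its colour changes sign; each of the
    three transpositions then preserves the difference of the two colours involved, as in
    \<open>0 - b = (- b) - 0\<close> and \<open>b - c = (- c) - (- b)\<close>.

  A shift, on the other hand, preserves linking and hence all colours, while it moves every
  occurrence by an odd number of positions; the invariant changes sign.  Hence any word with a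
  nonzero invariant is homotopic, but not open homotopic, to the word obtained from it by one
  shift.  The theorem needs only one such word, for which both values are computed.

  Geometrically, each entry of the word stands for a point reflection of the line, with the colour as
  its centre.  The alternating sum determines the composition of these reflections, a translation,
  and a shift conjugates that composition by one reflection, which inverts the translation.
\<close>

section \<open>Colours of letters\<close>

text \<open>
  The number of pairs of positions \<open>i < j\<close> such that the \<open>i\<close>-th entry is in \<open>S\<close> and the \<open>j\<close>-th
  entry is \<open>a\<close>.  If \<open>a\<close> occurs twice, the entries before its first occurrence are counted
  twice; modulo 2 there remain the entries in \<open>S\<close> from the first occurrence on up to
  the second one.  Among these, letters with both ends strictly between the two occurrences
  cancel, so what is counted modulo 2 is the letters in \<open>S\<close> linked with \<open>a\<close>, plus \<open>a\<close> itself
  if it is in \<open>S\<close>.  Unlike a definition through linking, this one has a simple value on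
  concatenations.
\<close>

primrec preceding :: "'a set \<Rightarrow> 'a list \<Rightarrow> 'a \<Rightarrow> nat" where
  "preceding S [] a = 0"
| "preceding S (x # w) a = preceding S w a + (if x \<in> S then count_list w a else 0)"

abbreviation number_in :: "'a set \<Rightarrow> 'a list \<Rightarrow> nat" where
  "number_in S w \<equiv> length (filter (\<lambda>x. x \<in> S) w)"

lemma preceding_append:
  "preceding S (u @ v) a = preceding S u a + preceding S v a + number_in S u * count_list v a"
  by (induction u) (auto simp: algebra_simps)

lemma preceding_notin: "a \<notin> set w \<Longrightarrow> preceding S w a = 0"
  by (induction w) auto

lemma preceding_cong:
  "(\<And>x. x \<in> set w \<Longrightarrow> x \<in> S \<longleftrightarrow> x \<in> T) \<Longrightarrow> preceding S w a = preceding T w a"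
  by (induction w) auto

lemma preceding_map:
  assumes "inj_on f (set w)" "a \<in> set w"
  shows "preceding S (map f w) (f a) = preceding (f -` S) w a"
proof -
  have "preceding S (map f u) (f a) = preceding (f -` S) u a" if "set u \<subseteq> set w" for u
    using that
  proof (induction u)
    case (Cons x u)
    have "count_list (map f u) (f a) = count_list u a"
      using Cons.prems inj_onD[OF assms(1) _ _ assms(2)] by (induction u) auto
    with Cons show ?case by simp
  qed simp
  then show ?thesis by simp
qed

text \<open>
  For \<open>S = UNIV\<close> the letter itself is among those counted, so a letter linked with an even
  number of letters has an odd count.
\<close>

definition even_letters :: "'a list \<Rightarrow> 'a set" where
  "even_letters w = {a. odd (preceding UNIV w a)}"

definition colour :: "'a list \<Rightarrow> 'a \<Rightarrow> int" where
  "colour w a = (if a \<in> even_letters w then 0 else (- 1) ^ preceding (even_letters w) w a)"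

lemma colour_cong:
  assumes "a \<in> even_letters u \<longleftrightarrow> a \<in> even_letters v"
    and "even (preceding (even_letters u) u a) \<longleftrightarrow> even (preceding (even_letters v) v a)"
  shows "colour u a = colour v a"
  using assms by (simp add: colour_def minus_one_power_iff)

primrec alternating_sum :: "int list \<Rightarrow> int" where
  "alternating_sum [] = 0"
| "alternating_sum (x # xs) = x - alternating_sum xs"

lemma alternating_sum_append:
  "alternating_sum (xs @ ys) = alternating_sum xs + (- 1) ^ length xs * alternating_sum ys"
  by (induction xs) auto

definition colour_sum :: "'a list \<Rightarrow> int" where
  "colour_sum w = alternating_sum (map (colour w) w)"

section \<open>Invariance under open homotopy\<close>

lemma gauss_word_count: "gauss_word w \<Longrightarrow> a \<in> set w \<Longrightarrow> count_list w a = 2"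
  by (auto simp: gauss_word_def gauss_word_on_def)

lemma colour_sum_iso:
  assumes "gauss_iso u v"
  shows "colour_sum u = colour_sum v"
proof -
  obtain f where inj: "inj_on f (set u)" and v: "v = map f u"
    using assms unfolding gauss_iso_def gauss_word_on_def bij_betw_def
    by (metis inj_on_subset)
  have E: "f a \<in> even_letters v \<longleftrightarrow> a \<in> even_letters u" if "a \<in> set u" for a
    using preceding_map[OF inj that, of UNIV] by (simp add: v even_letters_def)
  have "colour v (f a) = colour u a" if "a \<in> set u" for a
  proof -
    have "preceding (even_letters v) v (f a) = preceding (even_letters u) u a"
      unfolding v preceding_map[OF inj that] using E v by (intro preceding_cong) auto
    then show ?thesis using E[OF that] by (simp add: colour_def)
  qed
  then have "map (colour v) v = map (colour u) u" by (simp add: v)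
  then show ?thesis by (simp add: colour_sum_def)
qed

lemma colour_sum_H1:
  assumes "H1_move u v"
  shows "colour_sum u = colour_sum v"
  using assms
proof cases
  case (1 x A y)
  have notin: "A \<notin> set x" "A \<notin> set y"
    using gauss_word_count[OF 1(3), of A]
    by (auto simp: 1 count_list_0_iff)
  have other: "preceding S u a = preceding S v a + (if A \<in> S then 2 * count_list y a else 0)"
    if "a \<noteq> A" for S a
    using that by (simp add: 1(1,2) preceding_append algebra_simps)
  have E: "a \<in> even_letters u \<longleftrightarrow> a \<in> even_letters v" if "a \<noteq> A" for a
    using other[OF that, of UNIV] by (simp add: even_letters_def)
  have c: "colour u a = colour v a" if "a \<noteq> A" for a
  proof (rule colour_cong)
    have "preceding (even_letters u) v a = preceding (even_letters v) v a"
      using notin by (intro preceding_cong E) (auto simp: 1(2))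
    then show "even (preceding (even_letters u) u a) = even (preceding (even_letters v) v a)"
      using other[OF that, of "even_letters u"] by simp
  qed (use E that in simp)
  define f g where "f = colour u" and "g = colour v"
  have sums: "colour_sum u = alternating_sum (map f u)" "colour_sum v = alternating_sum (map g v)"
    by (simp_all add: colour_sum_def f_def g_def)
  have segments: "map f x = map g x" "map f y = map g y"
    unfolding f_def g_def using notin by (intro map_cong refl c; auto)+
  show ?thesis
    unfolding sums by (simp add: segments 1(1,2) alternating_sum_append)
qed

lemma colour_sum_H2:
  assumes "H2_move u v"
  shows "colour_sum u = colour_sum v"
  using assms
proof cases
  case (1 A B x y z)
  have notin: "A \<notin> set x" "A \<notin> set y" "A \<notin> set z" "B \<notin> set x" "B \<notin> set y" "B \<notin> set z"
    using gauss_word_count[OF 1(4), of A] gauss_word_count[OF 1(4), of B] 1(3)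
    by (auto simp: count_list_0_iff)
  have AB: "A \<in> even_letters u \<longleftrightarrow> B \<in> even_letters u"
    using 1(3) by (simp add: 1(1) even_letters_def preceding_append preceding_notin notin)
  have other: "preceding S u a
      = preceding S v a + (if A \<in> S then 2 * count_list y a + 4 * count_list z a else 0)"
    if "a \<noteq> A" "a \<noteq> B" "A \<in> S \<longleftrightarrow> B \<in> S" for S a
    using that by (simp add: 1(1,2) preceding_append algebra_simps)
  have E: "a \<in> even_letters u \<longleftrightarrow> a \<in> even_letters v" if "a \<noteq> A" "a \<noteq> B" for a
    using other[OF that, of UNIV] by (simp add: even_letters_def)
  have c: "colour u a = colour v a" if "a \<noteq> A" "a \<noteq> B" for a
  proof (rule colour_cong)
    have "preceding (even_letters u) v a = preceding (even_letters v) v a"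
      using notin by (intro preceding_cong E) (auto simp: 1(2))
    then show "even (preceding (even_letters u) u a) = even (preceding (even_letters v) v a)"
      using other[OF that AB] by simp
  qed (use E that in simp)
  have cAB: "colour u A = colour u B"
    using AB 1(3)
    by (auto simp: colour_def minus_one_power_iff, auto simp: 1(1) preceding_append preceding_notin notin)
  define f g where "f = colour u" and "g = colour v"
  have sums: "colour_sum u = alternating_sum (map f u)" "colour_sum v = alternating_sum (map g v)"
    by (simp_all add: colour_sum_def f_def g_def)
  have segments: "map f x = map g x" "map f y = map g y"
    "map f z = map g z"
    unfolding f_def g_def using notin by (intro map_cong refl c; auto)+
  show ?thesis
    unfolding sums by (simp add: segments cAB[folded f_def] 1(1,2) alternating_sum_append)
qed

lemma colour_sum_H3:
  assumes "H3_move u v"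
  shows "colour_sum u = colour_sum v"
  using assms
proof cases
  case (1 A B C x y z t)
  have ne: "A \<noteq> B" "A \<noteq> C" "B \<noteq> C" "B \<noteq> A" "C \<noteq> A" "C \<noteq> B" using 1(3) by auto
  have notin: "A \<notin> set x" "A \<notin> set y" "A \<notin> set z" "A \<notin> set t"
    "B \<notin> set x" "B \<notin> set y" "B \<notin> set z" "B \<notin> set t"
    "C \<notin> set x" "C \<notin> set y" "C \<notin> set z" "C \<notin> set t"
    using gauss_word_count[OF 1(4), of A] gauss_word_count[OF 1(4), of B]
      gauss_word_count[OF 1(4), of C] ne
    by (auto simp: count_list_0_iff)
  define E where "E = even_letters u"
  have other: "preceding S u a = preceding S v a" if "a \<noteq> A" "a \<noteq> B" "a \<noteq> C" for S a
    using that by (simp add: 1(1,2) preceding_append algebra_simps)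
  have A: "even (preceding S u A) \<longleftrightarrow> (even (preceding S v A) \<longleftrightarrow> (B \<in> S \<longleftrightarrow> C \<in> S))" for S
    using ne by (auto simp: 1(1,2) preceding_append preceding_notin notin)
  have B: "even (preceding S u B) \<longleftrightarrow> (even (preceding S v B) \<longleftrightarrow> (A \<in> S \<longleftrightarrow> C \<in> S))" for S
    using ne by (auto simp: 1(1,2) preceding_append preceding_notin notin)
  have C: "even (preceding S u C) \<longleftrightarrow> (even (preceding S v C) \<longleftrightarrow> (A \<in> S \<longleftrightarrow> B \<in> S))" for S
    using ne by (auto simp: 1(1,2) preceding_append preceding_notin notin)
  have "a \<in> even_letters v \<longleftrightarrow> a \<in> E" for a
    using other[of a UNIV] A[of UNIV] B[of UNIV] C[of UNIV]
    by (cases "a = A \<or> a = B \<or> a = C") (auto simp: E_def even_letters_def)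
  then have Ev: "even_letters v = E" by blast
  have c: "colour u a = colour v a" if "a \<noteq> A" "a \<noteq> B" "a \<noteq> C" for a
    using other[OF that] Ev by (simp add: colour_def E_def)
  \<comment> \<open>A fourth letter is linked with none or two of the three, and each link among the three counts
    for both of its ends; so the numbers of letters linked with \<open>A\<close>, \<open>B\<close>, \<open>C\<close> have an
    even sum, and none or two of the three letters are odd.\<close>
  have parity: "A \<in> E \<longleftrightarrow> (B \<in> E \<longleftrightarrow> C \<in> E)"
    using ne by (auto simp: E_def even_letters_def 1(1) preceding_append preceding_notin notin)
  have swaps: "colour u A - colour u C = colour v C - colour v A"
    "colour u B - colour u C = colour v C - colour v B"
    using parity A[of E] B[of E] C[of E]
    by (auto simp: colour_def Ev E_def[symmetric] minus_one_power_iff)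
  define f g where "f = colour u" and "g = colour v"
  have sums: "colour_sum u = alternating_sum (map f u)" "colour_sum v = alternating_sum (map g v)"
    by (simp_all add: colour_sum_def f_def g_def)
  have segments: "map f x = map g x" "map f y = map g y"
    "map f z = map g z" "map f t = map g t"
    unfolding f_def g_def using notin by (intro map_cong refl c; auto)+
  have corners: "f A = g C - g A + f C" "f B = g C - g B + f C"
    using swaps by (auto simp: f_def g_def)
  show ?thesis
    unfolding sums by (simp add: segments corners 1(1,2) alternating_sum_append algebra_simps)
qed

theorem colour_sum_open_homotopic:
  assumes "open_homotopic u v"
  shows "colour_sum u = colour_sum v"
proof -
  have "equivclp open_homotopy_step u v"
    using assms by (simp add: open_homotopic_def)
  then show ?thesis
    by (induction rule: equivclp_induct)
      (auto simp: open_homotopy_step_def dest: colour_sum_iso colour_sum_H1 colour_sum_H2 colour_sum_H3)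
qed

section \<open>Separating the two relations\<close>

theorem mainTheorem5:
  "\<exists>u v :: nat list. gauss_word u \<and> gauss_word v \<and> homotopic u v \<and> \<not> open_homotopic u v"
proof -
  \<comment> \<open>No Gauss word on fewer than five letters has a nonzero invariant.\<close>
  let ?x = "[1] :: nat list" and ?y = "[2, 3, 1, 4, 2, 4, 3] :: nat list"
  let ?u = "[0] @ ?x @ [0] @ ?y" and ?v = "?x @ [0] @ ?y @ [0]"
  have gauss: "gauss_word ?u" "gauss_word ?v"
    by (auto simp: gauss_word_def gauss_word_on_def intro!: exI[of _ "{0, 1, 2, 3, 4}"])
  then have "shift_move ?u ?v" by (rule shift_move.intros)
  then have "homotopic ?u ?v"
    unfolding homotopic_def homotopy_step_def using gauss by blast
  moreover have "colour_sum ?u = 8" "colour_sum ?v = - 8"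
    by (simp_all add: colour_sum_def colour_def even_letters_def)
  then have "\<not> open_homotopic ?u ?v"
    using colour_sum_open_homotopic[of ?u ?v] by auto
  ultimately show ?thesis using gauss by blast
qed

end
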